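(* Let $k\ge 2$ and let $\Sigma$ be a finite non-empty alphabet. A word $w\in\Sigma^*$ is a $k$-abelian singleton if and only if for each pair $x,y\in F_{k-1}(w)$ (including $x=y$) there is at most one return from $x$ to $y$ in $w$.
   Context: For a word $u$ and a non-empty word $x$, $|u|_x$ is the number of occurrences (overlapping ones included) of $x$ as a factor of $u$. Two words $u,v\in\Sigma^*$ are $k$-abelian equivalent if $|u|_x=|v|_x$ for all non-empty words $x$ of length at most $k$. A word $w$ is a $k$-abelian singleton if the only word $k$-abelian equivalent to $w$ is $w$ itself. $F_{k-1}(w)$ is the set of factors of $w$ of length $k-1$. A word $x$ is a proper factor of a word $z$ if $x$ occurs in the word obtained from $z$ by deleting its first and its last letter. For $x,y\in\Sigma^+$ of the same length, a return from $x$ to $y$ in $w$ is a non-empty word $v\in\Sigma^+$ such that $vy$ is a factor of $w$, $x$ is a prefix of $vy$, and neither $x$ nor $y$ occurs as a proper factor of $vy$. "At most one return" means at most one such word $v$ (not one occurrence). *)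

theory Defs
  imports Main "HOL-Library.Sublist"
begin

text \<open>
  Words over an alphabet \<open>\<Sigma>\<close> are elements of \<^term>\<open>lists \<Sigma>\<close>; \<open>x\<close> is a factor of \<open>w\<close> iff
  \<^term>\<open>sublist x w\<close> (contiguous, in the sense of \<open>HOL-Library.Sublist\<close>).
\<close>

text \<open>
  An occurrence of \<open>x\<close> in \<open>u\<close> is identified with the part \<open>p\<close> of \<open>u\<close> preceding it,
  so overlapping occurrences are counted separately.
\<close>
definition occ :: "'a list \<Rightarrow> 'a list \<Rightarrow> nat" where
  "occ u x = card {p. prefix (p @ x) u}"

definition k_abelian_equiv :: "'a set \<Rightarrow> nat \<Rightarrow> 'a list \<Rightarrow> 'a list \<Rightarrow> bool" where
  "k_abelian_equiv \<Sigma> k u v \<longleftrightarrow>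
     (\<forall>x \<in> lists \<Sigma>. x \<noteq> [] \<and> length x \<le> k \<longrightarrow> occ u x = occ v x)"

definition k_abelian_singleton :: "'a set \<Rightarrow> nat \<Rightarrow> 'a list \<Rightarrow> bool" where
  "k_abelian_singleton \<Sigma> k w \<longleftrightarrow> (\<forall>u \<in> lists \<Sigma>. k_abelian_equiv \<Sigma> k u w \<longrightarrow> u = w)"

definition factors :: "nat \<Rightarrow> 'a list \<Rightarrow> 'a list set" where
  "factors n w = {x. sublist x w \<and> length x = n}"

text \<open>
  Not \<^const>\<open>strict_sublist\<close>: a proper factor has an occurrence that is neither
  a prefix nor a suffix.
\<close>
definition proper_factor :: "'a list \<Rightarrow> 'a list \<Rightarrow> bool" where
  "proper_factor x z \<longleftrightarrow> sublist x (butlast (tl z))"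

text \<open>
  Returns are meant for non-empty \<open>x\<close>, \<open>y\<close> of equal length; \<open>v\<close> may be shorter
  than \<open>x\<close>, in which case \<open>x\<close> and the final \<open>y\<close> overlap in \<open>v @ y\<close>.
\<close>
definition is_return :: "'a list \<Rightarrow> 'a list \<Rightarrow> 'a list \<Rightarrow> 'a list \<Rightarrow> bool" where
  "is_return w x y v \<longleftrightarrow>
     v \<noteq> [] \<and> sublist (v @ y) w \<and> prefix x (v @ y) \<and>
     \<not> proper_factor x (v @ y) \<and> \<not> proper_factor y (v @ y)"

end

theory Submission
  imports Defs
begin

text \<open>
  Put \<open>m = k - 1\<close> and read a word as a walk in the de Bruijn graph: its vertices are the windows of
  length \<open>m\<close>, its edges the windows of length \<open>k\<close>. For words of length at least \<open>m\<close>,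
  \<open>k\<close>-abelian equivalence means that two walks start at the same vertex and use the same multiset of
  edges (the start is determined by \<open>occ_eq_sum_left_extensions\<close>). A return from \<open>x\<close> to \<open>y\<close> is
  a stretch of the walk from \<open>x\<close> to \<open>y\<close> that avoids both in between.

  Suppose that \<open>w\<close> is a singleton and contains two different returns from \<open>x\<close> to \<open>y\<close>. They cannot
  overlap, since an overlap would put \<open>x\<close> or \<open>y\<close> inside one of them. Exchanging them
  preserves start and edges (\<open>occ_switch\<close>) but changes the word, because the shorter return would
  exhibit a \<open>y\<close> inside the longer one (\<open>singleton_imp_same_return_if_less\<close>).

  Conversely, let returns in \<open>w\<close> be unique and let \<open>u \<noteq> w\<close> be equivalent to \<open>w\<close>. Drop the common
  beginning, so that both walks start at the vertex \<open>z\<close> where they part, \<open>w\<close> by the edge \<open>e\<close> and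
  \<open>u\<close> by the edge \<open>f\<close>. By uniqueness of the return from \<open>z\<close> to itself, \<open>w\<close> leaves \<open>z\<close> by
  \<open>e\<close> whenever it comes back to \<open>z\<close> afterwards, so it can use \<open>f\<close> only at its last visit to \<open>z\<close>. The
  vertices of \<open>w\<close> after this visit are different from all earlier ones: a common vertex \<open>y\<close> would
  yield two returns from \<open>z\<close> to \<open>y\<close>, one beginning with \<open>e\<close> and one with \<open>f\<close>. Hence edges of
  \<open>w\<close> never lead from the late vertices back to \<open>z\<close>, and \<open>u\<close>, which enters the late vertices by
  its first step, can never use \<open>e\<close>; but it has to (\<open>unique_returns_no_divergence\<close>).
\<close>

section \<open>Counting occurrences\<close>

lemma occ_Nil: "occ [] x = of_bool (x = [])"
proof -
  have "{p. prefix (p @ x) []} = (if x = [] then {[]} else {})" by auto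
  then show ?thesis by (simp add: occ_def)
qed

lemma occ_Cons: "occ (a # u) x = of_bool (prefix x (a # u)) + occ u x"
proof -
  have eq: "{p. prefix (p @ x) (a # u)} =
      (if prefix x (a # u) then {[]} else {}) \<union> Cons a ` {p. prefix (p @ x) u}"
    (is "?L = ?A \<union> ?B")
  proof (rule set_eqI)
    fix p show "p \<in> ?L \<longleftrightarrow> p \<in> ?A \<union> ?B"
      by (cases p) auto
  qed
  have fin: "finite {p. prefix (p @ x) u}"
    by (rule finite_subset[of _ "set (prefixes u)"]) (auto dest: append_prefixD)
  have "card (?A \<union> ?B) = card ?A + card ?B"
    by (rule card_Un_disjoint) (use fin in auto)
  also have "card ?B = occ u x"
    by (simp add: card_image occ_def)
  finally show ?thesis unfolding occ_def eq by simp
qed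

lemma occ_pos_iff_sublist: "0 < occ u x \<longleftrightarrow> sublist x u"
  by (induction u) (auto simp: occ_Nil occ_Cons sublist_Cons_right)

lemma occ_Nil_right: "occ u [] = Suc (length u)"
  by (induction u) (auto simp: occ_Nil occ_Cons)

text \<open>
  A window of length at most \<open>length y + 1\<close> that starts before the block \<open>y\<close> ends inside it,
  so it cannot see what follows \<open>y\<close>. This is why words can be cut and glued along
  common blocks of length \<open>k - 1\<close> without changing their short factors.
\<close>
lemma occ_append_overlap:
  assumes "prefix y r" and "length x \<le> Suc (length y)"
  shows "occ (s @ r) x + occ y x = occ (s @ y) x + occ r x"
proof (induction s)
  case Nil
  show ?case by simp
next
  case (Cons a s)
  obtain t where r: "r = y @ t" using assms(1) by (auto simp: prefix_def)
  have "prefix x ((a # s @ y) @ t) \<longleftrightarrow> prefix x (a # s @ y)"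
    (is "?L \<longleftrightarrow> ?R")
  proof
    assume ?L
    then show ?R by (rule prefix_length_prefix) (use assms(2) in auto)
  qed (rule prefix_prefix)
  then show ?case using Cons by (simp add: occ_Cons r)
qed

text \<open>
  Every occurrence of \<open>x\<close> is preceded by a letter, except one at the very beginning. Hence
  the counts of factors of length at most \<open>k\<close> determine the prefix of length \<open>k - 1\<close>.
\<close>
lemma occ_eq_sum_left_extensions:
  assumes "finite \<Sigma>" and "u \<in> lists \<Sigma>"
  shows "occ u x = (\<Sum>a\<in>\<Sigma>. occ u (a # x)) + of_bool (prefix x u)"
  using assms(2)
proof (induction u)
  case Nil
  then show ?case by (simp add: occ_Nil)
next
  case (Cons c u)
  have "(\<Sum>a\<in>\<Sigma>. of_bool (prefix (a # x) (c # u)) :: nat)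
      = (\<Sum>a\<in>\<Sigma>. if a = c then of_bool (prefix x u) else 0)"
    by (rule sum.cong) auto
  also have "\<dots> = of_bool (prefix x u)"
    using Cons assms(1) by simp
  finally show ?case using Cons by (simp add: occ_Cons sum.distrib)
qed

lemma k_abelian_equiv_imp_same_length:
  assumes "finite \<Sigma>" "u \<in> lists \<Sigma>" "w \<in> lists \<Sigma>" "k \<ge> 1" "k_abelian_equiv \<Sigma> k u w"
  shows "length u = length w"
proof -
  have "(\<Sum>a\<in>\<Sigma>. occ u [a]) = (\<Sum>a\<in>\<Sigma>. occ w [a])"
    using assms by (intro sum.cong) (auto simp: k_abelian_equiv_def)
  then show ?thesis
    using occ_eq_sum_left_extensions[OF assms(1,2), of "[]"]
      occ_eq_sum_left_extensions[OF assms(1,3), of "[]"]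
    by (simp add: occ_Nil_right)
qed

lemma k_abelian_equiv_imp_same_prefix:
  assumes "finite \<Sigma>" "u \<in> lists \<Sigma>" "w \<in> lists \<Sigma>" "k_abelian_equiv \<Sigma> k u w"
    and "prefix x w" "length x < k"
  shows "prefix x u"
proof (cases "x = []")
  case False
  have x: "x \<in> lists \<Sigma>" using assms(3,5) by (auto simp: prefix_def)
  have "occ u x = occ w x"
    using assms False x by (auto simp: k_abelian_equiv_def)
  moreover have "(\<Sum>a\<in>\<Sigma>. occ u (a # x)) = (\<Sum>a\<in>\<Sigma>. occ w (a # x))"
    using assms x by (intro sum.cong) (auto simp: k_abelian_equiv_def)
  ultimately show ?thesis
    using occ_eq_sum_left_extensions[OF assms(1,2), of x]
      occ_eq_sum_left_extensions[OF assms(1,3), of x] assms(5)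
    by (cases "prefix x u") auto
qed simp

section \<open>Windows and returns\<close>

definition window :: "nat \<Rightarrow> 'a list \<Rightarrow> nat \<Rightarrow> 'a list" where
  "window n u i = take n (drop i u)"

lemma length_window: "i + n \<le> length u \<Longrightarrow> length (window n u i) = n"
  by (simp add: window_def)

lemma take_window: "m \<le> n \<Longrightarrow> take m (window n u i) = window m u i"
  by (simp add: window_def)

lemma window_Suc_eqD:
  assumes "window (Suc m) u i = window (Suc m) w j"
  shows "window m u i = window m w j" "window m u (Suc i) = window m w (Suc j)"
proof -
  show "window m u i = window m w j"
    using arg_cong[OF assms, of "take m"] by (simp add: take_window)
  have "window m v (Suc l) = tl (window (Suc m) v l)" for v :: "'a list" and l
    by (simp add: window_def drop_Suc tl_drop tl_take)
  then show "window m u (Suc i) = window m w (Suc j)"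
    using assms by simp
qed

lemma window_add: "window (l + m) u i = window l u i @ window m u (i + l)"
  by (simp add: window_def take_add add.commute)

lemma window_split: "i \<le> j \<Longrightarrow> window (j - i + m) u i = window (j - i) u i @ window m u j"
  by (subst window_add) simp

lemma sublist_window: "sublist (window n u i) u"
  unfolding window_def by (meson sublist_drop sublist_take sublist_order.order_trans)

lemma window_append: "window n (a @ u) (length a + i) = window n u i"
  by (simp add: window_def)

lemma window_append_left: "i + n \<le> length u \<Longrightarrow> window n (u @ t) i = window n u i"
  by (simp add: window_def)

lemma window_window: "i + n \<le> l \<Longrightarrow> window n (window l u j) i = window n u (j + i)"
  by (simp add: window_def drop_take min_absorb1 add.commute)

lemma sublist_iff_window:
  "sublist x u \<longleftrightarrow> (\<exists>i. i + length x \<le> length u \<and> window (length x) u i = x)"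
proof
  assume "sublist x u"
  then obtain a t where "u = a @ x @ t" by (auto simp: sublist_def)
  then show "\<exists>i. i + length x \<le> length u \<and> window (length x) u i = x"
    by (intro exI[of _ "length a"]) (simp add: window_def)
next
  assume "\<exists>i. i + length x \<le> length u \<and> window (length x) u i = x"
  then obtain i where "window (length x) u i = x" by blast
  then show "sublist x u" by (metis sublist_window)
qed

text \<open>
  An occurrence of a return is recorded by the positions of its two end vertices. Comparing positions
  is what makes it possible to speak of the order of two returns and of first and last visits.
\<close>
definition return_between :: "nat \<Rightarrow> 'a list \<Rightarrow> nat \<Rightarrow> nat \<Rightarrow> bool" where
  "return_between m w i j \<longleftrightarrow> i < j \<and> j + m \<le> length w \<and>
     (\<forall>l. i < l \<and> l < j \<longrightarrow> window m w l \<noteq> window m w i \<and> window m w l \<noteq> window m w j)"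

text \<open>
  Deleting the first and the last letter excludes exactly the windows at the two end positions.
\<close>
lemma proper_factor_window_iff:
  assumes "i < j" "j + m \<le> length w" "length x = m" "m > 0"
  shows "proper_factor x (window (j - i + m) w i) \<longleftrightarrow> (\<exists>l. i < l \<and> l < j \<and> window m w l = x)"
proof -
  have inner: "butlast (tl (window (j - i + m) w i)) = window (j - i + m - 2) w (Suc i)"
    using assms
    by (simp add: window_def butlast_conv_take tl_take drop_Suc tl_drop flip: drop_Suc)
  have len: "length (window (j - i + m - 2) w (Suc i)) = j - i + m - 2"
    using assms by (intro length_window) auto
  show ?thesis
  proof
    assume "proper_factor x (window (j - i + m) w i)"
    then obtain d where d: "d + m \<le> j - i + m - 2" "window m (window (j - i + m - 2) w (Suc i)) d = x"
      unfolding proper_factor_def inner sublist_iff_window len assms(3) by blast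
    then have "window m w (Suc i + d) = x" by (simp add: window_window)
    then show "\<exists>l. i < l \<and> l < j \<and> window m w l = x"
      using d(1) assms by (intro exI[of _ "Suc i + d"]) auto
  next
    assume "\<exists>l. i < l \<and> l < j \<and> window m w l = x"
    then obtain l where l: "i < l" "l < j" "window m w l = x" by blast
    have "window m (window (j - i + m - 2) w (Suc i)) (l - Suc i) = x"
      using l assms by (subst window_window) auto
    then show "proper_factor x (window (j - i + m) w i)"
      unfolding proper_factor_def inner sublist_iff_window len assms(3)
      using l assms(1,2,4) by (intro exI[of _ "l - Suc i"]) auto
  qed
qed

lemma is_return_iff_return_between:
  assumes "length x = m" "length y = m" "m > 0"
  shows "is_return w x y v \<longleftrightarrow>
    (\<exists>i j. return_between m w i j \<and> window m w i = x \<and> window m w j = y \<and> v = window (j - i) w i)"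
proof
  assume R: "is_return w x y v"
  then obtain i where i: "i + length (v @ y) \<le> length w" "window (length (v @ y)) w i = v @ y"
    unfolding is_return_def sublist_iff_window by blast
  define j where "j = i + length v"
  have ij: "i < j" "j + m \<le> length w" using R i(1) assms by (auto simp: j_def is_return_def)
  have vy: "window (j - i + m) w i = v @ y" using i(2) assms by (simp add: j_def)
  have "window (j - i) w i @ window m w j = v @ y"
    using vy ij window_split[of i j m w] by simp
  then have v: "v = window (j - i) w i" and y: "window m w j = y"
    using ij assms by (auto simp: length_window)
  have "take m (v @ y) = x" using R assms(1) by (metis append_eq_conv_conj is_return_def prefix_def)
  then have x: "window m w i = x" using vy by (metis take_window le_add2)
  have "return_between m w i j"
    using R ij proper_factor_window_iff[OF ij assms(1,3)] proper_factor_window_iff[OF ij assms(2,3)]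
    unfolding return_between_def is_return_def vy x y by blast
  then show "\<exists>i j. return_between m w i j \<and> window m w i = x \<and> window m w j = y \<and>
      v = window (j - i) w i"
    using x y v by blast
next
  assume "\<exists>i j. return_between m w i j \<and> window m w i = x \<and> window m w j = y \<and>
      v = window (j - i) w i"
  then obtain i j where R: "return_between m w i j" "window m w i = x" "window m w j = y"
    and v: "v = window (j - i) w i" by blast
  have ij: "i < j" "j + m \<le> length w" using R by (auto simp: return_between_def)
  have vy: "v @ y = window (j - i + m) w i" using v R ij window_split[of i j m w] by simp
  have "v \<noteq> []" using v ij length_window[of i "j - i" w] by auto
  moreover have "sublist (v @ y) w"
    unfolding vy by (rule sublist_window)
  moreover have "prefix x (v @ y)"
    unfolding vy using R(2) by (metis take_is_prefix take_window le_add2)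
  ultimately show "is_return w x y v"
    using R proper_factor_window_iff[OF ij assms(1,3)] proper_factor_window_iff[OF ij assms(2,3)]
    unfolding return_between_def is_return_def vy by blast
qed

definition unique_returns :: "nat \<Rightarrow> 'a list \<Rightarrow> bool" where
  "unique_returns m w \<longleftrightarrow> (\<forall>i j i' j'. return_between m w i j \<and> return_between m w i' j' \<and>
     window m w i = window m w i' \<and> window m w j = window m w j' \<longrightarrow>
     window (j - i) w i = window (j' - i') w i')"

lemma unique_returns_iff:
  assumes "m > 0"
  shows "(\<forall>x \<in> factors m w. \<forall>y \<in> factors m w. \<exists>\<^sub>\<le>\<^sub>1 v. is_return w x y v) \<longleftrightarrow> unique_returns m w"
proof -
  have fac: "window m w i \<in> factors m w" if "i + m \<le> length w" for i
    using that sublist_iff_window[of "window m w i" w] by (auto simp: factors_def length_window)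
  have len: "length x = m" if "x \<in> factors m w" for x using that by (simp add: factors_def)
  show ?thesis
  proof
    assume U: "\<forall>x \<in> factors m w. \<forall>y \<in> factors m w. \<exists>\<^sub>\<le>\<^sub>1 v. is_return w x y v"
    show "unique_returns m w"
      unfolding unique_returns_def
    proof (intro allI impI, elim conjE)
      fix i j i' j'
      assume R: "return_between m w i j" "return_between m w i' j'"
        and e: "window m w i = window m w i'" "window m w j = window m w j'"
      have f: "window m w i \<in> factors m w" "window m w j \<in> factors m w"
        using R by (auto intro!: fac simp: return_between_def)
      have "is_return w (window m w i) (window m w j) (window (j - i) w i)"
        "is_return w (window m w i) (window m w j) (window (j' - i') w i')"
        using R e is_return_iff_return_between[OF len[OF f(1)] len[OF f(2)] assms] by metis+
      then show "window (j - i) w i = window (j' - i') w i'"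
        using U f unfolding Uniq_def by blast
    qed
  next
    assume "unique_returns m w"
    then show "\<forall>x \<in> factors m w. \<forall>y \<in> factors m w. \<exists>\<^sub>\<le>\<^sub>1 v. is_return w x y v"
      by (auto simp: Uniq_def is_return_iff_return_between[OF len len assms] unique_returns_def)
  qed
qed

section \<open>Distinct returns can be switched\<close>

text \<open>
  The hypotheses say that the walk visits \<open>x\<close>, \<open>y\<close>, \<open>x\<close>, \<open>y\<close> at the four cuts, and that it still
  does so when \<open>v\<close> and \<open>v'\<close> are exchanged. By \<open>occ_append_overlap\<close> each piece then contributes
  an amount that depends only on the piece and on the vertex at its right end.
\<close>
lemma occ_switch:
  assumes "length x = n" "length y = n" "length z \<le> Suc n"
    and "prefix x (v @ y)" "prefix x (v' @ y)" "prefix y (b @ x)" "prefix y c"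
  shows "occ (a @ v @ b @ v' @ c) z = occ (a @ v' @ b @ v @ c) z"
proof -
  have glue: "prefix p (s @ r)" if "prefix p (s @ q)" "prefix q r" for p q r s :: "'a list"
    using that by (metis prefix_order.trans same_prefix_prefix)
  have px: "prefix x (v @ c)" "prefix x (v' @ c)" using assms glue by blast+
  have py: "prefix y (b @ v @ c)" "prefix y (b @ v' @ c)" using px assms glue by blast+
  have px': "prefix x (v @ b @ v' @ c)" "prefix x (v' @ b @ v @ c)" using py assms glue by blast+
  show ?thesis
    using occ_append_overlap[OF px'(1), of z a] occ_append_overlap[OF px'(2), of z a]
      occ_append_overlap[OF py(1), of z v'] occ_append_overlap[OF py(2), of z v]
      occ_append_overlap[OF px(1), of z b] occ_append_overlap[OF px(2), of z b]
      occ_append_overlap[OF assms(7), of z v] occ_append_overlap[OF assms(7), of z v'] assms(1-3)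
    by simp
qed

text \<open>
  The first return ends no later than the second begins, since otherwise the second occurrence of
  \<open>x\<close> would lie inside the first return. So \<open>w\<close> splits into five pieces, and the two
  returns can be exchanged.
\<close>
lemma singleton_imp_same_return_if_less:
  assumes sing: "k_abelian_singleton \<Sigma> (Suc m) w" and w: "w \<in> lists \<Sigma>"
    and R: "return_between m w i j" "return_between m w i' j'"
    and e: "window m w i = window m w i'" "window m w j = window m w j'"
    and less: "i < i'"
  shows "window (j - i) w i = window (j' - i') w i'"
proof -
  have ij: "i < j" "i' < j'" "j' + m \<le> length w" "j + m \<le> length w"
    using R by (auto simp: return_between_def)
  have "j \<le> i'" using R(1) e less by (metis not_le return_between_def)
  define x y where "x = window m w i" and "y = window m w j"
  define a v b v' c where "a = take i w" and "v = window (j - i) w i"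
    and "b = window (i' - j) w j" and "v' = window (j' - i') w i'" and "c = drop j' w"
  have dr: "drop p w = window (q - p) w p @ drop q w" if "p \<le> q" for p q
    using that by (simp add: window_def) (metis append_take_drop_id drop_drop le_add_diff_inverse2)
  have w_eq: "w = a @ v @ b @ v' @ c"
    unfolding a_def v_def b_def v'_def c_def
    using dr[of i j] dr[of j i'] dr[of i' j'] ij \<open>j \<le> i'\<close> by (metis append_take_drop_id less_imp_le)
  have lens: "length a = i" "length v = j - i" "length v' = j' - i'" "length b = i' - j"
    using ij \<open>j \<le> i'\<close> by (auto simp: a_def v_def b_def v'_def length_window)
  have vy: "v @ y = window (j - i + m) w i" "v' @ y = window (j' - i' + m) w i'"
    "b @ x = window (i' - j + m) w j"
    using ij \<open>j \<le> i'\<close> e window_split[of i j m w] window_split[of i' j' m w] window_split[of j i' m w]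
    by (auto simp: v_def v'_def b_def x_def y_def)
  have pw: "prefix (window m w p) (window (d + m) w p)" for p d
    by (metis take_is_prefix take_window le_add2)
  have P: "prefix x (v @ y)" "prefix x (v' @ y)" "prefix y (b @ x)" "prefix y c"
  proof -
    show "prefix x (v @ y)" unfolding vy x_def by (rule pw)
    show "prefix x (v' @ y)" unfolding vy x_def e by (rule pw)
    show "prefix y (b @ x)" unfolding vy y_def by (rule pw)
    show "prefix y c" unfolding y_def e(2) unfolding c_def window_def by (rule take_is_prefix)
  qed
  define u where "u = a @ v' @ b @ v @ c"
  have len: "length x = m" "length y = m" using ij by (auto simp: x_def y_def length_window)
  have "k_abelian_equiv \<Sigma> (Suc m) u w"
    using occ_switch[OF len _ P] by (simp add: k_abelian_equiv_def u_def w_eq)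
  moreover have "u \<in> lists \<Sigma>" using w unfolding u_def w_eq by auto
  ultimately have uw: "u = w" using sing by (auto simp: k_abelian_singleton_def)
  obtain s where s: "b @ v @ c = y @ s"
  proof -
    obtain t where c: "c = y @ t" using P(4) by (auto simp: prefix_def)
    obtain t1 where t1: "v @ y = x @ t1" using P(1) by (auto simp: prefix_def)
    obtain t2 where t2: "b @ x = y @ t2" using P(3) by (auto simp: prefix_def)
    have "b @ v @ c = b @ (v @ y) @ t" by (simp add: c)
    also have "\<dots> = (b @ x) @ t1 @ t" by (simp add: t1)
    also have "\<dots> = y @ t2 @ t1 @ t" by (simp add: t2)
    finally show thesis using that by blast
  qed
  consider "length v = length v'" | "length v < length v'" | "length v' < length v" by linarith
  then show ?thesis
  proof cases
    case 1
    have "a @ v' @ b @ v @ c = a @ v @ b @ v' @ c" using uw w_eq u_def by metis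
    then have "v = v'" using 1 by (metis append_eq_append_conv same_append_eq)
    then show ?thesis by (simp only: v_def v'_def)
  next
    case 2
    \<comment> \<open>In the switched word \<open>v' @ y\<close> stands where \<open>w\<close> has \<open>v @ y\<close>, so the \<open>y\<close> that ends the shorter
      return shows up strictly inside the longer one.\<close>
    have "y = window m w (i + length v)" using ij lens by (simp add: y_def)
    also have "\<dots> = window m (v' @ y) (length v)"
    proof -
      have "w = a @ (v' @ y) @ s" using uw s by (simp add: u_def)
      then have "window m w (i + length v) = window m ((v' @ y) @ s) (length v)"
        using window_append[of m a "(v' @ y) @ s" "length v"] lens by simp
      also have "\<dots> = window m (v' @ y) (length v)"
        by (rule window_append_left) (use 2 len in simp)
      finally show ?thesis .
    qed
    also have "\<dots> = window m w (i' + length v)"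
      unfolding vy using 2 lens by (subst window_window) auto
    finally have "window m w (i' + length v) = window m w j'" using e by (simp add: y_def)
    moreover have "i' < i' + length v" "i' + length v < j'" using 2 lens ij by auto
    ultimately show ?thesis using R(2) unfolding return_between_def by blast
  next
    case 3
    have "window m u (i + length v') = y"
    proof -
      show ?thesis unfolding u_def s using lens len by (simp add: window_def)
    qed
    then have "window m w (i + length v') = window m w j" by (simp add: uw y_def)
    moreover have "i < i + length v'" "i + length v' < j" using 3 lens ij by auto
    ultimately show ?thesis using R(1) unfolding return_between_def by blast
  qed
qed

lemma singleton_imp_unique_returns:
  assumes "k_abelian_singleton \<Sigma> (Suc m) w" and "w \<in> lists \<Sigma>"
  shows "unique_returns m w"
  unfolding unique_returns_def
proof (intro allI impI, elim conjE)
  fix i j i' j'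
  assume R: "return_between m w i j" "return_between m w i' j'"
    and e: "window m w i = window m w i'" "window m w j = window m w j'"
  consider "i = i'" | "i < i'" | "i' < i" by linarith
  then show "window (j - i) w i = window (j' - i') w i'"
  proof cases
    case 1
    then have "j = j'" using R e unfolding return_between_def by (metis linorder_neqE_nat)
    then show ?thesis using 1 by simp
  next
    case 2
    then show ?thesis using singleton_imp_same_return_if_less[OF assms R e] by simp
  next
    case 3
    then show ?thesis using singleton_imp_same_return_if_less[OF assms R(2,1) e[symmetric]] by simp
  qed
qed

section \<open>Unique returns force the word\<close>

lemma first_window_after:
  assumes "i < q" "window m w q = y"
  obtains q' where "i < q'" "q' \<le> q" "window m w q' = y"
    "\<And>l. i < l \<Longrightarrow> l < q' \<Longrightarrow> window m w l \<noteq> y"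
proof -
  define q' where "q' = (LEAST l. i < l \<and> window m w l = y)"
  have "i < q' \<and> window m w q' = y" unfolding q'_def using assms by (rule LeastI[OF conjI])
  moreover have "q' \<le> q" unfolding q'_def using assms by (simp add: Least_le)
  moreover have "window m w l \<noteq> y" if "i < l" "l < q'" for l
    using that not_less_Least unfolding q'_def by blast
  ultimately show thesis using that by blast
qed

lemma unique_returns_suffix:
  assumes "unique_returns m (a @ w)"
  shows "unique_returns m w"
proof -
  have tr: "return_between m (a @ w) (length a + i) (length a + j)" if "return_between m w i j" for i j
    unfolding return_between_def
  proof (intro conjI allI impI)
    fix l assume l: "length a + i < l \<and> l < length a + j"
    then obtain d where "l = length a + d" using less_imp_add_positive by (metis le_add1 le_Suc_ex less_imp_le order_trans)
    then show "window m (a @ w) l \<noteq> window m (a @ w) (length a + i)"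
      "window m (a @ w) l \<noteq> window m (a @ w) (length a + j)"
      using l that by (auto simp: window_append return_between_def)
  qed (use that in \<open>auto simp: return_between_def\<close>)
  show ?thesis
    unfolding unique_returns_def
  proof (intro allI impI, elim conjE)
    fix i j i' j'
    assume "return_between m w i j" "return_between m w i' j'"
      "window m w i = window m w i'" "window m w j = window m w j'"
    then have "window (length a + j - (length a + i)) (a @ w) (length a + i)
        = window (length a + j' - (length a + i')) (a @ w) (length a + i')"
      by (intro assms[unfolded unique_returns_def, rule_format]) (simp add: tr window_append)
    then show "window (j - i) w i = window (j' - i') w i'" by (simp add: window_append)
  qed
qed

text \<open>A return \<open>v\<close> is non-empty, so \<open>v @ y\<close> has length at least \<open>m + 1\<close> and contains the
  first edge of the return as a prefix.\<close>
lemma unique_returns_same_edge: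
  assumes "unique_returns m w" "return_between m w i j" "return_between m w i' j'"
    and "window m w i = window m w i'" "window m w j = window m w j'"
  shows "window (Suc m) w i = window (Suc m) w i'"
proof -
  have ij: "i < j" "i' < j'" using assms by (auto simp: return_between_def)
  have "window (j - i) w i = window (j' - i') w i'" using assms unfolding unique_returns_def by blast
  then have "window (j - i + m) w i = window (j' - i' + m) w i'"
    using assms(5) ij window_split[of i j m w] window_split[of i' j' m w] by simp
  then have "take (Suc m) (window (j - i + m) w i) = take (Suc m) (window (j' - i' + m) w i')"
    by simp
  then show ?thesis using ij by (simp add: take_window)
qed

text \<open>
  If the first edges differed, \<open>u\<close> would step directly to the vertices that \<open>w\<close> reaches only after its
  last visit to the common start. These are new to \<open>w\<close> at that point, so its edges do not lead out
  of them, and \<open>u\<close> is trapped there without ever using the first edge of \<open>w\<close>.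
\<close>
lemma unique_returns_no_divergence:
  fixes u w :: "'a list"
  assumes uniq: "unique_returns m w"
    and edges: "\<And>x. length x = Suc m \<Longrightarrow> sublist x u \<longleftrightarrow> sublist x w"
    and len: "m < length u" "m < length w"
    and start: "window m u 0 = window m w 0"
  shows "window (Suc m) u 0 = window (Suc m) w 0"
proof (rule ccontr)
  assume diff: "window (Suc m) u 0 \<noteq> window (Suc m) w 0"
  define V where "V = window m w"
  define z where "z = V 0"
  have edge_at: "\<exists>l'. l' + m < length t \<and> window (Suc m) t l' = window (Suc m) s l"
    if "l + m < length s" "(s, t) \<in> {(u, w), (w, u)}" for s t l
  proof -
    have "sublist (window (Suc m) s l) t"
      using edges[of "window (Suc m) s l"] sublist_window[of "Suc m" s l] that
      by (auto simp: length_window)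
    then show ?thesis using that(1) by (auto simp: sublist_iff_window length_window Suc_le_eq)
  qed
  define J where "J = {l. l + m \<le> length w \<and> V l = z}"
  define j where "j = Max J"
  have J: "finite J" "0 \<in> J"
    using len by (auto simp: J_def z_def intro: finite_subset[of _ "{..length w}"])
  then have "j \<in> J" unfolding j_def using Max_in by blast
  then have j: "j + m \<le> length w" "V j = z" by (auto simp: J_def)
  have j_last: "l \<le> j" if "l + m \<le> length w" "V l = z" for l
    using that J by (simp add: j_def J_def)
  have exit: "window (Suc m) w i = window (Suc m) w 0" if "V i = z" "i < j" for i
  proof -
    have ret: "\<exists>q. return_between m w i' q \<and> V q = z" if i': "V i' = z" "i' < j" for i'
    proof -
      obtain q where "i' < q" "q \<le> j" "V q = z" "\<And>l. i' < l \<Longrightarrow> l < q \<Longrightarrow> V l \<noteq> z"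
        using first_window_after[of i' j m w z] i' j unfolding V_def by metis
      then show ?thesis using i' j by (intro exI[of _ q]) (auto simp: return_between_def V_def)
    qed
    have "0 < j" using that by simp
    with ret[OF that] ret[of 0] show ?thesis
      using unique_returns_same_edge[OF uniq] that unfolding z_def V_def by metis
  qed
  \<comment> \<open>The first edge of \<open>u\<close> leaves \<open>z\<close> and occurs in \<open>w\<close>; the last visit is the only place left for it.\<close>
  have j_exit: "j + m < length w" "window (Suc m) w j = window (Suc m) u 0"
  proof -
    obtain l where l: "l + m < length w" "window (Suc m) w l = window (Suc m) u 0"
      using edge_at[of 0 u w] len by auto
    then have "V l = z" using window_Suc_eqD(1)[OF l(2)] start by (simp add: V_def z_def)
    then have "l = j" using exit[of l] j_last[of l] l diff by force
    then show "j + m < length w" "window (Suc m) w j = window (Suc m) u 0" using l by auto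
  qed
  have disjoint: "V p \<noteq> V q" if pq: "p \<le> j" "j < q" "q + m \<le> length w" for p q
  proof
    assume eq: "V p = V q"
    define y where "y = V q"
    have yz: "y \<noteq> z" using j_last[of q] pq by (auto simp: y_def)
    \<comment> \<open>From the last \<open>z\<close> up to \<open>p\<close> to the next \<open>y\<close>, and from the last \<open>z\<close> of all to the next \<open>y\<close>:
      two returns with different first edges.\<close>
    define I where "I = {l. l \<le> p \<and> V l = z}"
    define i where "i = Max I"
    have I: "finite I" "0 \<in> I" by (auto simp: I_def z_def)
    then have "i \<in> I" unfolding i_def using Max_in by blast
    then have i: "i \<le> p" "V i = z" by (auto simp: I_def)
    have i_last: "l \<le> i" if "l \<le> p" "V l = z" for l using that I by (simp add: i_def I_def)
    have "i < p" using i eq yz by (metis le_neq_implies_less y_def)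
    then obtain p' where p': "i < p'" "p' \<le> p" "V p' = y" "\<And>l. i < l \<Longrightarrow> l < p' \<Longrightarrow> V l \<noteq> y"
      using first_window_after[of i p m w y] eq unfolding V_def y_def by metis
    obtain q' where q': "j < q'" "q' \<le> q" "V q' = y" "\<And>l. j < l \<Longrightarrow> l < q' \<Longrightarrow> V l \<noteq> y"
      using first_window_after[of j q m w y] pq unfolding V_def y_def by metis
    have "return_between m w i p'"
      unfolding return_between_def V_def[symmetric]
    proof (intro conjI allI impI)
      show "V l \<noteq> V i" if "i < l \<and> l < p'" for l
        using i_last[of l] that p'(2) i(2) by auto
    qed (use p' pq j in auto)
    moreover have "return_between m w j q'"
      unfolding return_between_def V_def[symmetric]
    proof (intro conjI allI impI)
      show "V l \<noteq> V j" if "j < l \<and> l < q'" for l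
        using j_last[of l] that q'(2) pq j(2) by auto
    qed (use q' pq in auto)
    ultimately have "window (Suc m) w i = window (Suc m) w j"
      using unique_returns_same_edge[OF uniq] i j p' q' unfolding V_def by metis
    moreover have "window (Suc m) w i = window (Suc m) w 0"
      using exit i \<open>i < p\<close> pq by simp
    ultimately show False using diff j_exit by simp
  qed
  have trapped: "\<exists>q. j < q \<and> q + m \<le> length w \<and> window m u (Suc l) = V q" if "Suc l + m \<le> length u" for l
    using that
  proof (induction l)
    case 0
    show ?case
      using window_Suc_eqD(2)[OF j_exit(2)] j_exit(1) by (intro exI[of _ "Suc j"]) (auto simp: V_def)
  next
    case (Suc l)
    then obtain q where q: "j < q" "q + m \<le> length w" "window m u (Suc l) = V q" by auto
    obtain r where r: "r + m < length w" "window (Suc m) w r = window (Suc m) u (Suc l)"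
      using edge_at[of "Suc l" u w] Suc.prems by auto
    have "V r = V q" using window_Suc_eqD(1)[OF r(2)] q by (simp add: V_def)
    then have "j < r" using disjoint[of r q] q by force
    then show ?case
      using window_Suc_eqD(2)[OF r(2)] r(1) by (intro exI[of _ "Suc r"]) (auto simp: V_def)
  qed
  obtain l where l: "l + m < length u" "window (Suc m) u l = window (Suc m) w 0"
    using edge_at[of 0 w u] len by auto
  then have lz: "window m u l = z" using window_Suc_eqD(1)[OF l(2)] by (simp add: V_def z_def)
  obtain l' where "l = Suc l'" using diff l(2) by (cases l) auto
  then obtain q where "j < q" "q + m \<le> length w" "V q = z"
    using trapped[of l'] l(1) lz by auto
  then show False using j_last[of q] by simp
qed

text \<open>
  Cut off the longest common prefix except for its last \<open>m\<close> letters. The cut removes the same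
  occurrences from both words, so the remaining parts still have the same edges.
\<close>
lemma unique_returns_imp_singleton:
  assumes fin: "finite \<Sigma>" and w: "w \<in> lists \<Sigma>" and uniq: "unique_returns m w"
  shows "k_abelian_singleton \<Sigma> (Suc m) w"
  unfolding k_abelian_singleton_def
proof (intro ballI impI, rule ccontr)
  fix u assume u: "u \<in> lists \<Sigma>" and eqv: "k_abelian_equiv \<Sigma> (Suc m) u w" and "u \<noteq> w"
  have len: "length u = length w"
    using k_abelian_equiv_imp_same_length[OF fin u w _ eqv] by simp
  obtain p d s c r where dc: "d \<noteq> c" and u_eq: "u = p @ [d] @ s" and w_eq: "w = p @ [c] @ r"
    using same_length_different[OF \<open>u \<noteq> w\<close> len] by blast
  have pre: "take m w = take m u"
  proof -
    have "prefix (take m w) u"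
      using k_abelian_equiv_imp_same_prefix[OF fin u w eqv take_is_prefix] by simp
    then have "take (length (take m w)) u = take m w" by (auto elim!: prefixE simp: min_def)
    then show ?thesis using len by (simp add: min_def split: if_splits)
  qed
  have mp: "m \<le> length p"
  proof (rule ccontr)
    assume "\<not> m \<le> length p"
    then have "take m w ! length p = c" "take m u ! length p = d" by (auto simp: u_eq w_eq nth_append)
    then show False using pre dc by simp
  qed
  define q z where "q = take (length p - m) p" and "z = drop (length p - m) p"
  have p: "p = q @ z" and z: "length z = m" using mp by (auto simp: q_def z_def)
  define u' w' where "u' = z @ d # s" and "w' = z @ c # r"
  have uw: "u = q @ u'" "w = q @ w'" by (auto simp: u_eq w_eq p u'_def w'_def)
  have "sublist x u' \<longleftrightarrow> sublist x w'" if x: "length x = Suc m" for x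
  proof (cases "x \<in> lists \<Sigma>")
    case True
    have "occ u x = occ w x"
      using eqv True x unfolding k_abelian_equiv_def by (metis le_refl list.size(3) nat.distinct(1))
    moreover have "occ u x + occ z x = occ (q @ z) x + occ u' x"
      "occ w x + occ z x = occ (q @ z) x + occ w' x"
      unfolding uw using x z by (auto intro!: occ_append_overlap simp: u'_def w'_def)
    ultimately have "occ u' x = occ w' x" by simp
    then show ?thesis by (metis occ_pos_iff_sublist)
  next
    case False
    have "x \<in> lists \<Sigma>" if "sublist x t" "t \<in> lists \<Sigma>" for t
      using that by (auto simp: sublist_def)
    moreover have "u' \<in> lists \<Sigma>" "w' \<in> lists \<Sigma>" using u w by (auto simp: uw)
    ultimately show ?thesis using False by blast
  qed
  moreover have "window m u' 0 = window m w' 0" by (simp add: window_def u'_def w'_def z)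
  moreover have "unique_returns m w'" using uniq unique_returns_suffix uw by blast
  ultimately have "window (Suc m) u' 0 = window (Suc m) w' 0"
    by (intro unique_returns_no_divergence) (auto simp: u'_def w'_def z)
  then show False using dc by (simp add: window_def u'_def w'_def z)
qed

theorem proposition5p3:
  fixes \<Sigma> :: "'a set" and k :: nat and w :: "'a list"
  assumes "k \<ge> 2"
    and "finite \<Sigma>" and "\<Sigma> \<noteq> {}"
    and "w \<in> lists \<Sigma>"
  shows "k_abelian_singleton \<Sigma> k w \<longleftrightarrow>
    (\<forall>x \<in> factors (k - 1) w. \<forall>y \<in> factors (k - 1) w. \<exists>\<^sub>\<le>\<^sub>1 v. is_return w x y v)"
proof -
  have k: "k = Suc (k - 1)" "k - 1 > 0" using assms(1) by auto
  show ?thesis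
    unfolding unique_returns_iff[OF k(2)]
    using singleton_imp_unique_returns[of \<Sigma> "k - 1" w] unique_returns_imp_singleton[of \<Sigma> w "k - 1"]
      assms(2,4) k(1) by metis
qed

end
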